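(* Let $\mathbf{C}$ be a sheathed dagger category and let $(A,m\colon A\otimes A\to A,u\colon I\to A)$ be a monoid in $\mathbf{C}$. Then $(A,m,u)$ is a dagger Frobenius monoid if and only if $$i_{[A,A]}\circ R=R_*\circ i_A\colon A\to[A,A]^*.$$
   Context: A dagger on a category $\mathbf{D}$ is a functor $\dagger\colon\mathbf{D}^{\mathrm{op}}\to\mathbf{D}$ with $A^\dagger=A$ on objects and $f^{\dagger\dagger}=f$ on morphisms; a dagger category is a category with a chosen dagger. A morphism $f$ is unitary if it is an isomorphism with $f^{-1}=f^\dagger$. A monoidal dagger category is a dagger category that is also a monoidal category, with $(f\otimes g)^\dagger=f^\dagger\otimes g^\dagger$, and whose coherence maps $\lambda\colon I\otimes A\to A$, $\rho\colon A\otimes I\to A$, $\alpha\colon(A\otimes B)\otimes C\to A\otimes(B\otimes C)$ are unitary. A monoid $(A,m,u)$ in a monoidal dagger category is a dagger Frobenius monoid if $$(m\otimes\mathrm{id}_A)\circ\alpha^{-1}\circ(\mathrm{id}_A\otimes m^\dagger)=(\mathrm{id}_A\otimes m)\circ\alpha\circ(m^\dagger\otimes\mathrm{id}_A).$$ Closed monoidal means there is a natural correspondence (currying) between morphisms $A\otimes B\to C$ and $A\to[B,C]$. Write $A^*=[A,I]$, and write $\mathrm{ev}_{[A,A]}\colon[A,A]\otimes A\to A$ for the evaluation (counit). The object $[A,A]$ is canonically a monoid: its multiplication $\hat m$ is obtained by currying $\mathrm{ev}_{[A,A]}\circ(\mathrm{id}\otimes\mathrm{ev}_{[A,A]})\circ\alpha\colon([A,A]\otimes[A,A])\otimes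 A\to A$, and its unit $\hat u$ by currying $\lambda_A\colon I\otimes A\to A$. A sheathed dagger category is a monoidal dagger category that is also closed monoidal, such that for all objects $A$ $$\lambda_A\circ\big((\hat u^\dagger\circ\hat m)\otimes\mathrm{id}_A\big)\circ\alpha^{-1}\circ\big(\mathrm{id}_{[A,A]}\otimes\mathrm{ev}_{[A,A]}^\dagger\big)=\mathrm{ev}_{[A,A]}\colon[A,A]\otimes A\to A,$$ and for all objects $A,B,C$ and morphisms $f,g\colon B\to C\otimes[A,A]$: if $(\mathrm{id}_C\otimes\mathrm{ev}_{[A,A]})\circ\alpha\circ(f\otimes\mathrm{id}_A)=(\mathrm{id}_C\otimes\mathrm{ev}_{[A,A]})\circ\alpha\circ(g\otimes\mathrm{id}_A)$, then $f=g$. For a monoid $(M,m_M,u_M)$, $i_M\colon M\to M^*$ is obtained by currying $u_M^\dagger\circ m_M\colon M\otimes M\to I$; in particular $i_A$ uses the given monoid $(A,m,u)$, and $i_{[A,A]}$ uses $([A,A],\hat m,\hat u)$. The map $R\colon A\to[A,A]$ is obtained by currying $m\colon A\otimes A\to A$, and $R_*=[R^\dagger,\mathrm{id}_I]\colon A^*\to[A,A]^*$. *)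

theory Defs
  imports Main
begin

text \<open>
  A single record carries all the data; each locale below constrains only the fields it is about.
  Arrows form one type with domain and codomain maps, objects and arrows being carved out by
  carriers. Nothing is said about the values of operations on ill-typed arguments.

  Conventions: \<open>g \<cdot> f\<close> is \<open>g\<close> after \<open>f\<close>; \<open>\<otimes>\<close> is the tensor of objects and \<open>\<boxtimes>\<close> that of arrows;
  \<open>ihom C A B\<close> is the object $[A,B]$, and for \<open>f : A' \<rightarrow> A\<close>, \<open>g : B \<rightarrow> B'\<close> the arrow
  \<open>ihom_arr C f g\<close> is $[f,g] : [A,B] \to [A',B']$; \<open>curry C A B D\<close> sends arrows \<open>A \<otimes> B \<rightarrow> D\<close>
  to arrows \<open>A \<rightarrow> [B,D]\<close>. It takes the objects as arguments because \<open>\<otimes>\<close> need not be injective on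
  objects.
\<close>

record ('o, 'a) dagger_closed_data =
  Obj :: "'o set"
  Arr :: "'a set"
  Dom :: "'a \<Rightarrow> 'o"
  Cod :: "'a \<Rightarrow> 'o"
  ident :: "'o \<Rightarrow> 'a"  ("\<one>\<index>")
  compose :: "'a \<Rightarrow> 'a \<Rightarrow> 'a"  (infixr "\<cdot>\<index>" 55)
  dagger :: "'a \<Rightarrow> 'a"  ("(_\<dagger>\<index>)" [1000] 999)
  tensor :: "'o \<Rightarrow> 'o \<Rightarrow> 'o"  (infixl "\<otimes>\<index>" 70)
  tensor_arr :: "'a \<Rightarrow> 'a \<Rightarrow> 'a"  (infixl "\<boxtimes>\<index>" 70)
  unit_obj :: "'o"  ("\<I>\<index>")
  lunit :: "'o \<Rightarrow> 'a"
  runit :: "'o \<Rightarrow> 'a"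
  assoc :: "'o \<Rightarrow> 'o \<Rightarrow> 'o \<Rightarrow> 'a"
  ihom :: "'o \<Rightarrow> 'o \<Rightarrow> 'o"
  ihom_arr :: "'a \<Rightarrow> 'a \<Rightarrow> 'a"
  curry :: "'o \<Rightarrow> 'o \<Rightarrow> 'o \<Rightarrow> 'a \<Rightarrow> 'a"

hide_const (open) Product_Type.curry

context
  fixes C :: "('o, 'a, 'x) dagger_closed_data_scheme" (structure)
begin

definition hom :: "'o \<Rightarrow> 'o \<Rightarrow> 'a set" where
  "hom A B = {f \<in> Arr C. Dom C f = A \<and> Cod C f = B}"

definition is_inverse :: "'a \<Rightarrow> 'a \<Rightarrow> bool" where
  "is_inverse f g \<longleftrightarrow>
     g \<in> hom (Cod C f) (Dom C f) \<and> g \<cdot> f = \<one> (Dom C f) \<and> f \<cdot> g = \<one> (Cod C f)"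

definition is_iso :: "'a \<Rightarrow> bool" where
  "is_iso f \<longleftrightarrow> f \<in> Arr C \<and> (\<exists>g. is_inverse f g)"

definition inv_arr :: "'a \<Rightarrow> 'a" where
  "inv_arr f = (THE g. is_inverse f g)"

definition unitary :: "'a \<Rightarrow> bool" where
  "unitary f \<longleftrightarrow> is_iso f \<and> inv_arr f = f\<dagger>"

text \<open>Evaluation is the counit: the arrow whose currying is the identity of $[B,D]$.\<close>

definition ev :: "'o \<Rightarrow> 'o \<Rightarrow> 'a" where
  "ev B D = the_inv_into (hom (ihom C B D \<otimes> B) D) (curry C (ihom C B D) B D) (\<one> (ihom C B D))"

definition monoid_object :: "'o \<Rightarrow> 'a \<Rightarrow> 'a \<Rightarrow> bool" where
  "monoid_object A m u \<longleftrightarrow>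
     A \<in> Obj C \<and> m \<in> hom (A \<otimes> A) A \<and> u \<in> hom \<I> A \<and>
     m \<cdot> (m \<boxtimes> \<one> A) = m \<cdot> (\<one> A \<boxtimes> m) \<cdot> assoc C A A A \<and>
     m \<cdot> (u \<boxtimes> \<one> A) = lunit C A \<and>
     m \<cdot> (\<one> A \<boxtimes> u) = runit C A"

definition dagger_frobenius_monoid :: "'o \<Rightarrow> 'a \<Rightarrow> 'a \<Rightarrow> bool" where
  "dagger_frobenius_monoid A m u \<longleftrightarrow>
     monoid_object A m u \<and>
     (m \<boxtimes> \<one> A) \<cdot> inv_arr (assoc C A A A) \<cdot> (\<one> A \<boxtimes> m\<dagger>)
       = (\<one> A \<boxtimes> m) \<cdot> assoc C A A A \<cdot> (m\<dagger> \<boxtimes> \<one> A)"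

text \<open>The canonical monoid structure $(\hat m, \hat u)$ on $[A,A]$.\<close>

definition end_mult :: "'o \<Rightarrow> 'a" where
  "end_mult A =
     (let E = ihom C A A in
      curry C (E \<otimes> E) A A (ev A A \<cdot> (\<one> E \<boxtimes> ev A A) \<cdot> assoc C E E A))"

definition end_unit :: "'o \<Rightarrow> 'a" where
  "end_unit A = curry C \<I> A A (lunit C A)"

text \<open>
  \<open>to_dual C M m u\<close> is $i_M : M \to M^* = [M,I]$, \<open>cayley C A m\<close> is $R : A \to [A,A]$, and
  \<open>cayley_dual C A m\<close> is $R_* : A^* \to [A,A]^*$.
\<close>

definition to_dual :: "'o \<Rightarrow> 'a \<Rightarrow> 'a \<Rightarrow> 'a" where
  "to_dual M m u = curry C M M \<I> (u\<dagger> \<cdot> m)"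

definition cayley :: "'o \<Rightarrow> 'a \<Rightarrow> 'a" where
  "cayley A m = curry C A A A m"

definition cayley_dual :: "'o \<Rightarrow> 'a \<Rightarrow> 'a" where
  "cayley_dual A m = ihom_arr C ((cayley A m)\<dagger>) (\<one> \<I>)"

end

locale category =
  fixes C :: "('o, 'a, 'x) dagger_closed_data_scheme" (structure)
  assumes Dom_Obj: "f \<in> Arr C \<Longrightarrow> Dom C f \<in> Obj C"
    and Cod_Obj: "f \<in> Arr C \<Longrightarrow> Cod C f \<in> Obj C"
    and ident_hom: "A \<in> Obj C \<Longrightarrow> \<one> A \<in> hom C A A"
    and comp_hom: "\<lbrakk>f \<in> hom C A B; g \<in> hom C B D\<rbrakk> \<Longrightarrow> g \<cdot> f \<in> hom C A D"
    and comp_ident_left: "f \<in> hom C A B \<Longrightarrow> \<one> B \<cdot> f = f"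
    and comp_ident_right: "f \<in> hom C A B \<Longrightarrow> f \<cdot> \<one> A = f"
    and comp_assoc: "\<lbrakk>f \<in> hom C A B; g \<in> hom C B D; h \<in> hom C D E\<rbrakk>
                       \<Longrightarrow> (h \<cdot> g) \<cdot> f = h \<cdot> (g \<cdot> f)"

locale dagger_category = category +
  assumes dagger_hom: "f \<in> hom C A B \<Longrightarrow> f\<dagger> \<in> hom C B A"
    and dagger_ident: "A \<in> Obj C \<Longrightarrow> (\<one> A)\<dagger> = \<one> A"
    and dagger_comp: "\<lbrakk>f \<in> hom C A B; g \<in> hom C B D\<rbrakk> \<Longrightarrow> (g \<cdot> f)\<dagger> = f\<dagger> \<cdot> g\<dagger>"
    and dagger_dagger: "f \<in> Arr C \<Longrightarrow> (f\<dagger>)\<dagger> = f"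

locale monoidal_category = category +
  assumes tensor_Obj: "\<lbrakk>A \<in> Obj C; B \<in> Obj C\<rbrakk> \<Longrightarrow> A \<otimes> B \<in> Obj C"
    and tensor_hom: "\<lbrakk>f \<in> hom C A B; g \<in> hom C A' B'\<rbrakk> \<Longrightarrow> f \<boxtimes> g \<in> hom C (A \<otimes> A') (B \<otimes> B')"
    and tensor_ident: "\<lbrakk>A \<in> Obj C; B \<in> Obj C\<rbrakk> \<Longrightarrow> \<one> A \<boxtimes> \<one> B = \<one> (A \<otimes> B)"
    and tensor_comp:
      "\<lbrakk>f \<in> hom C A B; g \<in> hom C B D; f' \<in> hom C A' B'; g' \<in> hom C B' D'\<rbrakk>
         \<Longrightarrow> (g \<cdot> f) \<boxtimes> (g' \<cdot> f') = (g \<boxtimes> g') \<cdot> (f \<boxtimes> f')"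
    and unit_Obj: "\<I> \<in> Obj C"
    and lunit_hom: "A \<in> Obj C \<Longrightarrow> lunit C A \<in> hom C (\<I> \<otimes> A) A"
    and lunit_iso: "A \<in> Obj C \<Longrightarrow> is_iso C (lunit C A)"
    and lunit_natural: "f \<in> hom C A B \<Longrightarrow> lunit C B \<cdot> (\<one> \<I> \<boxtimes> f) = f \<cdot> lunit C A"
    and runit_hom: "A \<in> Obj C \<Longrightarrow> runit C A \<in> hom C (A \<otimes> \<I>) A"
    and runit_iso: "A \<in> Obj C \<Longrightarrow> is_iso C (runit C A)"
    and runit_natural: "f \<in> hom C A B \<Longrightarrow> runit C B \<cdot> (f \<boxtimes> \<one> \<I>) = f \<cdot> runit C A"
    and assoc_hom: "\<lbrakk>A \<in> Obj C; B \<in> Obj C; D \<in> Obj C\<rbrakk>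
                      \<Longrightarrow> assoc C A B D \<in> hom C ((A \<otimes> B) \<otimes> D) (A \<otimes> (B \<otimes> D))"
    and assoc_iso: "\<lbrakk>A \<in> Obj C; B \<in> Obj C; D \<in> Obj C\<rbrakk> \<Longrightarrow> is_iso C (assoc C A B D)"
    and assoc_natural:
      "\<lbrakk>f \<in> hom C A A'; g \<in> hom C B B'; h \<in> hom C D D'\<rbrakk>
         \<Longrightarrow> assoc C A' B' D' \<cdot> ((f \<boxtimes> g) \<boxtimes> h) = (f \<boxtimes> (g \<boxtimes> h)) \<cdot> assoc C A B D"
    and triangle: "\<lbrakk>A \<in> Obj C; B \<in> Obj C\<rbrakk>
                     \<Longrightarrow> (\<one> A \<boxtimes> lunit C B) \<cdot> assoc C A \<I> B = runit C A \<boxtimes> \<one> B"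
    and pentagon:
      "\<lbrakk>A \<in> Obj C; B \<in> Obj C; D \<in> Obj C; E \<in> Obj C\<rbrakk>
         \<Longrightarrow> assoc C A B (D \<otimes> E) \<cdot> assoc C (A \<otimes> B) D E
             = (\<one> A \<boxtimes> assoc C B D E) \<cdot> assoc C A (B \<otimes> D) E \<cdot> (assoc C A B D \<boxtimes> \<one> E)"

locale monoidal_dagger_category = dagger_category + monoidal_category +
  assumes dagger_tensor: "\<lbrakk>f \<in> Arr C; g \<in> Arr C\<rbrakk> \<Longrightarrow> (f \<boxtimes> g)\<dagger> = f\<dagger> \<boxtimes> g\<dagger>"
    and lunit_unitary: "A \<in> Obj C \<Longrightarrow> unitary C (lunit C A)"
    and runit_unitary: "A \<in> Obj C \<Longrightarrow> unitary C (runit C A)"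
    and assoc_unitary: "\<lbrakk>A \<in> Obj C; B \<in> Obj C; D \<in> Obj C\<rbrakk> \<Longrightarrow> unitary C (assoc C A B D)"

text \<open>
  $[B,-]$ is right adjoint to $- \otimes B$. The internal hom functor is part of the data, and currying
  is natural in all three variables.
\<close>

locale closed_monoidal_category = monoidal_category +
  assumes ihom_Obj: "\<lbrakk>A \<in> Obj C; B \<in> Obj C\<rbrakk> \<Longrightarrow> ihom C A B \<in> Obj C"
    and ihom_arr_hom: "\<lbrakk>f \<in> hom C A' A; g \<in> hom C B B'\<rbrakk>
                         \<Longrightarrow> ihom_arr C f g \<in> hom C (ihom C A B) (ihom C A' B')"
    and ihom_arr_ident: "\<lbrakk>A \<in> Obj C; B \<in> Obj C\<rbrakk> \<Longrightarrow> ihom_arr C (\<one> A) (\<one> B) = \<one> (ihom C A B)"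
    and ihom_arr_comp:
      "\<lbrakk>f \<in> hom C A' A; f' \<in> hom C A'' A'; g \<in> hom C B B'; g' \<in> hom C B' B''\<rbrakk>
         \<Longrightarrow> ihom_arr C (f \<cdot> f') (g' \<cdot> g) = ihom_arr C f' g' \<cdot> ihom_arr C f g"
    and curry_bij: "\<lbrakk>A \<in> Obj C; B \<in> Obj C; D \<in> Obj C\<rbrakk>
                      \<Longrightarrow> bij_betw (curry C A B D) (hom C (A \<otimes> B) D) (hom C A (ihom C B D))"
    and curry_natural:
      "\<lbrakk>f \<in> hom C (A \<otimes> B) D; a \<in> hom C A' A; b \<in> hom C B' B; d \<in> hom C D D';
        A \<in> Obj C; B \<in> Obj C\<rbrakk>
         \<Longrightarrow> curry C A' B' D' (d \<cdot> f \<cdot> (a \<boxtimes> b)) = ihom_arr C b d \<cdot> curry C A B D f \<cdot> a"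

locale sheathed_dagger_category = monoidal_dagger_category + closed_monoidal_category +
  assumes ev_dagger:
      "\<lbrakk>A \<in> Obj C; E = ihom C A A\<rbrakk>
         \<Longrightarrow> lunit C A \<cdot> (((end_unit C A)\<dagger> \<cdot> end_mult C A) \<boxtimes> \<one> A)
               \<cdot> inv_arr C (assoc C E E A) \<cdot> (\<one> E \<boxtimes> (ev C A A)\<dagger>)
             = ev C A A"
    and ev_separates:
      "\<lbrakk>A \<in> Obj C; B \<in> Obj C; D \<in> Obj C; E = ihom C A A;
        f \<in> hom C B (D \<otimes> E); g \<in> hom C B (D \<otimes> E);
        (\<one> D \<boxtimes> ev C A A) \<cdot> assoc C D E A \<cdot> (f \<boxtimes> \<one> A)
          = (\<one> D \<boxtimes> ev C A A) \<cdot> assoc C D E A \<cdot> (g \<boxtimes> \<one> A)\<rbrakk>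
         \<Longrightarrow> f = g"

end

theory Submission
  imports Defs
begin

text \<open>
  Both composites are curried arrows $A \otimes [A,A] \to I$; take their daggers and separate them by
  evaluation. Since $\mathrm{ev} \circ (R \otimes \mathrm{id}) = m$ and the sheathing axiom computes
  $\mathrm{ev}^\dagger$ from $\hat m^\dagger \circ \hat u$, the equation
  $i_{[A,A]} \circ R = R_* \circ i_A$ turns into
  $(\mathrm{id} \otimes m) \circ \alpha \circ ((m^\dagger \circ u) \otimes \mathrm{id}) = m^\dagger \circ \lambda$.
  The Frobenius law gives this after precomposing with $u \otimes \mathrm{id}$. Conversely, by
  associativity it makes the right-hand side of the Frobenius law equal to the self-adjoint arrow
  $m^\dagger \circ m$, while the left-hand side is the dagger of the right-hand side.
\<close>

section \<open>Typing rules, uniqueness of inverses, cancellation of isomorphisms\<close>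

context category
begin

text \<open>Typing is stated as equations on \<open>Dom\<close> and \<open>Cod\<close>, so that the
  simplifier can discharge the side conditions of every categorical law by rewriting.\<close>

lemma hom_iff: "f \<in> hom C A B \<longleftrightarrow> f \<in> Arr C \<and> Dom C f = A \<and> Cod C f = B"
  by (simp add: hom_def)

lemma ident_simps [simp]:
  assumes "A \<in> Obj C"
  shows "\<one> A \<in> Arr C" "Dom C (\<one> A) = A" "Cod C (\<one> A) = A"
  using ident_hom[OF assms] by (auto simp: hom_iff)

lemma comp_simps [simp]:
  assumes "f \<in> Arr C" "g \<in> Arr C" "Dom C g = Cod C f"
  shows "g \<cdot> f \<in> Arr C" "Dom C (g \<cdot> f) = Dom C f" "Cod C (g \<cdot> f) = Cod C g"
  using comp_hom[of f "Dom C f" "Cod C f" g "Cod C g"] assms by (auto simp: hom_iff)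

lemma ident_comp [simp]: "f \<in> Arr C \<Longrightarrow> Cod C f = B \<Longrightarrow> \<one> B \<cdot> f = f"
  using comp_ident_left[of f "Dom C f" B] by (simp add: hom_iff)

lemma comp_ident [simp]: "f \<in> Arr C \<Longrightarrow> Dom C f = A \<Longrightarrow> f \<cdot> \<one> A = f"
  using comp_ident_right[of f A "Cod C f"] by (simp add: hom_iff)

lemma comp_assoc_arr:
  assumes "f \<in> Arr C" "g \<in> Arr C" "h \<in> Arr C" "Dom C g = Cod C f" "Dom C h = Cod C g"
  shows "(h \<cdot> g) \<cdot> f = h \<cdot> (g \<cdot> f)"
  using comp_assoc[of f "Dom C f" "Cod C f" g "Cod C g" h "Cod C h"] assms by (simp add: hom_iff)

text \<open>Two-sided inverses are unique, because \<open>h = h \<cdot> f \<cdot> g = g\<close>.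
  This gives the definite description in \<open>inv_arr\<close> its meaning.\<close>

lemma inv_arr_eqI:
  assumes "is_inverse C f g" "f \<in> Arr C"
  shows "inv_arr C f = g"
  unfolding inv_arr_def
proof (rule the_equality)
  fix h assume h: "is_inverse C f h"
  have "h = h \<cdot> f \<cdot> g"
    using assms h by (simp add: is_inverse_def hom_iff)
  also have "\<dots> = (h \<cdot> f) \<cdot> g"
    using assms h by (intro comp_assoc_arr[symmetric]) (simp_all add: is_inverse_def hom_iff)
  also have "\<dots> = g"
    using assms h by (simp add: is_inverse_def hom_iff)
  finally show "h = g" .
qed fact

lemma is_inverse_inv_arr:
  assumes "is_iso C f"
  shows "is_inverse C f (inv_arr C f)"
  using assms inv_arr_eqI[of f] by (auto simp: is_iso_def)

lemma iso_cancel_right: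
  assumes "is_iso C h" "f \<in> Arr C" "g \<in> Arr C" "Dom C f = Cod C h" "Dom C g = Cod C h"
    and eq: "f \<cdot> h = g \<cdot> h"
  shows "f = g"
proof -
  have h: "h \<in> Arr C" "is_inverse C h (inv_arr C h)"
    using assms(1) is_inverse_inv_arr by (auto simp: is_iso_def)
  have "f = (f \<cdot> h) \<cdot> inv_arr C h"
    using assms(1-5) h by (simp add: is_inverse_def hom_iff comp_assoc_arr)
  also have "\<dots> = g"
    unfolding eq using assms(1-5) h by (simp add: is_inverse_def hom_iff comp_assoc_arr)
  finally show ?thesis .
qed

end

section \<open>The dagger as an involution; unitary arrows\<close>

context dagger_category
begin

lemma dagger_simps [simp]:
  assumes "f \<in> Arr C"
  shows "f\<dagger> \<in> Arr C" "Dom C (f\<dagger>) = Cod C f" "Cod C (f\<dagger>) = Dom C f" "(f\<dagger>)\<dagger> = f"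
  using dagger_hom[of f "Dom C f" "Cod C f"] assms by (auto simp: hom_iff dagger_dagger)

lemma dagger_comp_arr:
  "f \<in> Arr C \<Longrightarrow> g \<in> Arr C \<Longrightarrow> Dom C g = Cod C f \<Longrightarrow> (g \<cdot> f)\<dagger> = f\<dagger> \<cdot> g\<dagger>"
  using dagger_comp[of f "Dom C f" "Cod C f" g "Cod C g"] by (simp add: hom_iff)

lemma dagger_inject:
  "f \<in> Arr C \<Longrightarrow> g \<in> Arr C \<Longrightarrow> f\<dagger> = g\<dagger> \<longleftrightarrow> f = g"
  by (metis dagger_dagger)

lemma unitary_comp_dagger:
  assumes "unitary C f"
  shows "f\<dagger> \<cdot> f = \<one> (Dom C f)" "f \<cdot> f\<dagger> = \<one> (Cod C f)"
  using assms is_inverse_inv_arr[of f] by (auto simp: unitary_def is_inverse_def)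

end

section \<open>Interchange and coherence of the left unitor\<close>

context monoidal_category
begin

lemma tensor_simps [simp]:
  assumes "f \<in> Arr C" "g \<in> Arr C"
  shows "f \<boxtimes> g \<in> Arr C" "Dom C (f \<boxtimes> g) = Dom C f \<otimes> Dom C g"
    "Cod C (f \<boxtimes> g) = Cod C f \<otimes> Cod C g"
  using tensor_hom[of f "Dom C f" "Cod C f" g "Dom C g" "Cod C g"] assms by (auto simp: hom_iff)

lemma interchange:
  assumes "f \<in> Arr C" "g \<in> Arr C" "f' \<in> Arr C" "g' \<in> Arr C" "Dom C g = Cod C f" "Dom C g' = Cod C f'"
  shows "(g \<boxtimes> g') \<cdot> (f \<boxtimes> f') = (g \<cdot> f) \<boxtimes> (g' \<cdot> f')"
  using tensor_comp[of f "Dom C f" "Cod C f" g "Cod C g" f' "Dom C f'" "Cod C f'" g' "Cod C g'"] assms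
  by (simp add: hom_iff)

text \<open>The interchange law for use inside a right-nested composite, where the two tensors are
  followed by a further factor \<open>h\<close>.\<close>

lemma interchange_comp:
  assumes "f \<in> Arr C" "g \<in> Arr C" "f' \<in> Arr C" "g' \<in> Arr C" "Dom C g = Cod C f" "Dom C g' = Cod C f'"
    "h \<in> Arr C" "Cod C h = Dom C f \<otimes> Dom C f'"
  shows "(g \<boxtimes> g') \<cdot> (f \<boxtimes> f') \<cdot> h = ((g \<cdot> f) \<boxtimes> (g' \<cdot> f')) \<cdot> h"
  using assms by (simp add: interchange flip: comp_assoc_arr)

lemmas [simp] = tensor_Obj unit_Obj tensor_ident

lemma unitor_simps [simp]:
  assumes "A \<in> Obj C"
  shows "lunit C A \<in> Arr C" "Dom C (lunit C A) = \<I> \<otimes> A" "Cod C (lunit C A) = A"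
    "runit C A \<in> Arr C" "Dom C (runit C A) = A \<otimes> \<I>" "Cod C (runit C A) = A"
  using lunit_hom[OF assms] runit_hom[OF assms] by (auto simp: hom_iff)

lemma assoc_simps [simp]:
  assumes "A \<in> Obj C" "B \<in> Obj C" "D \<in> Obj C"
  shows "assoc C A B D \<in> Arr C" "Dom C (assoc C A B D) = A \<otimes> B \<otimes> D"
    "Cod C (assoc C A B D) = A \<otimes> (B \<otimes> D)"
  using assoc_hom[OF assms] by (auto simp: hom_iff)

lemma Dom_Cod_Obj [simp]: "f \<in> Arr C \<Longrightarrow> Dom C f \<in> Obj C" "f \<in> Arr C \<Longrightarrow> Cod C f \<in> Obj C"
  by (auto intro: Dom_Obj Cod_Obj)

lemma assoc_natural_arr:
  assumes "f \<in> Arr C" "g \<in> Arr C" "h \<in> Arr C"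
    "Cod C f = A'" "Cod C g = B'" "Cod C h = D'"
  shows "assoc C A' B' D' \<cdot> ((f \<boxtimes> g) \<boxtimes> h)
    = (f \<boxtimes> (g \<boxtimes> h)) \<cdot> assoc C (Dom C f) (Dom C g) (Dom C h)"
  using assoc_natural[of f "Dom C f" A' g "Dom C g" B' h "Dom C h" D'] assms by (simp add: hom_iff)

lemma lunit_natural_arr:
  assumes "f \<in> Arr C" "Cod C f = B"
  shows "lunit C B \<cdot> (\<one> \<I> \<boxtimes> f) = f \<cdot> lunit C (Dom C f)"
  using lunit_natural[of f "Dom C f" B] assms by (simp add: hom_iff)

text \<open>By naturality, \<open>lunit\<close> carries \<open>\<one> \<I> \<boxtimes> f\<close> to
  \<open>f \<cdot> lunit\<close>, and \<open>lunit\<close> can be cancelled because it is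
  invertible.\<close>

lemma unit_tensor_faithful:
  assumes "f \<in> Arr C" "g \<in> Arr C" "Dom C f = Dom C g" "Cod C f = Cod C g"
    and eq: "\<one> \<I> \<boxtimes> f = \<one> \<I> \<boxtimes> g"
  shows "f = g"
proof (rule iso_cancel_right)
  show "is_iso C (lunit C (Dom C f))"
    using assms(1) by (intro lunit_iso) simp
  show "f \<cdot> lunit C (Dom C f) = g \<cdot> lunit C (Dom C f)"
    using assms lunit_natural_arr[of f "Cod C f"] lunit_natural_arr[of g "Cod C g"] by metis
qed (use assms in auto)

lemma is_iso_tensor_ident:
  assumes "is_iso C f" "B \<in> Obj C"
  shows "is_iso C (f \<boxtimes> \<one> B)"
proof -
  have f: "f \<in> Arr C" and inv: "is_inverse C f (inv_arr C f)"
    using assms(1) is_inverse_inv_arr by (auto simp: is_iso_def)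
  then have "is_inverse C (f \<boxtimes> \<one> B) (inv_arr C f \<boxtimes> \<one> B)"
    using assms(2) by (simp add: is_inverse_def hom_iff interchange)
  then show ?thesis
    using f assms(2) by (auto simp: is_iso_def)
qed

text \<open>
  Kelly's derivation of this coherence from the pentagon and the triangle, after tensoring with
  \<open>\<I>\<close> on the left.
\<close>

lemma lunit_tensor:
  assumes A: "A \<in> Obj C" and B: "B \<in> Obj C"
  shows "lunit C (A \<otimes> B) \<cdot> assoc C \<I> A B = lunit C A \<boxtimes> \<one> B"
proof (rule unit_tensor_faithful)
  note [simp] = A B
  let ?l = "lunit C (A \<otimes> B) \<cdot> assoc C \<I> A B"
  \<comment> \<open>With \<open>?a\<close> and \<open>?b\<close> precomposed,
    \<open>\<one> \<I> \<boxtimes> assoc C \<I> A B\<close> completes the three-arrow side of the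
    pentagon for \<open>\<I>\<close>, \<open>\<I>\<close>, \<open>A\<close>, \<open>B\<close>. The
    triangle is then used twice, at \<open>A \<otimes> B\<close> and at \<open>A\<close>.\<close>
  let ?a = "assoc C \<I> (\<I> \<otimes> A) B" and ?b = "assoc C \<I> \<I> A \<boxtimes> \<one> B"
  have "((\<one> \<I> \<boxtimes> ?l) \<cdot> ?a) \<cdot> ?b
      = (\<one> \<I> \<boxtimes> lunit C (A \<otimes> B)) \<cdot> (\<one> \<I> \<boxtimes> assoc C \<I> A B) \<cdot> ?a \<cdot> ?b"
    by (simp add: comp_assoc_arr interchange_comp)
  also have "\<dots> = ((\<one> \<I> \<boxtimes> lunit C (A \<otimes> B)) \<cdot> assoc C \<I> \<I> (A \<otimes> B)) \<cdot> assoc C (\<I> \<otimes> \<I>) A B"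
    by (simp add: pentagon[symmetric] comp_assoc_arr)
  also have "\<dots> = (runit C \<I> \<boxtimes> (\<one> A \<boxtimes> \<one> B)) \<cdot> assoc C (\<I> \<otimes> \<I>) A B"
    by (simp add: triangle)
  also have "\<dots> = assoc C \<I> A B \<cdot> ((runit C \<I> \<boxtimes> \<one> A) \<boxtimes> \<one> B)"
    by (simp add: assoc_natural_arr del: tensor_ident)
  also have "\<dots> = assoc C \<I> A B \<cdot> ((\<one> \<I> \<boxtimes> lunit C A) \<boxtimes> \<one> B) \<cdot> ?b"
    by (simp add: interchange triangle)
  also have "\<dots> = (assoc C \<I> A B \<cdot> ((\<one> \<I> \<boxtimes> lunit C A) \<boxtimes> \<one> B)) \<cdot> ?b"
    by (simp add: comp_assoc_arr)
  also have "\<dots> = ((\<one> \<I> \<boxtimes> (lunit C A \<boxtimes> \<one> B)) \<cdot> ?a) \<cdot> ?b"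
    by (simp add: assoc_natural_arr)
  finally have eq: "((\<one> \<I> \<boxtimes> ?l) \<cdot> ?a) \<cdot> ?b = ((\<one> \<I> \<boxtimes> (lunit C A \<boxtimes> \<one> B)) \<cdot> ?a) \<cdot> ?b" .
  \<comment> \<open>The auxiliary associators are isomorphisms: first \<open>?b\<close> is
    cancelled, then \<open>?a\<close>.\<close>
  have "(\<one> \<I> \<boxtimes> ?l) \<cdot> ?a = (\<one> \<I> \<boxtimes> (lunit C A \<boxtimes> \<one> B)) \<cdot> ?a"
    by (rule iso_cancel_right[OF _ _ _ _ _ eq]) (simp_all add: is_iso_tensor_ident assoc_iso)
  then show "\<one> \<I> \<boxtimes> ?l = \<one> \<I> \<boxtimes> (lunit C A \<boxtimes> \<one> B)"
    by (rule iso_cancel_right[rotated -1]) (simp_all add: assoc_iso)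
qed (use A B in simp_all)

end

section \<open>Reduction of the Frobenius law to an equation with the unit\<close>

context monoidal_dagger_category
begin

lemma inv_assoc:
  "\<lbrakk>A \<in> Obj C; B \<in> Obj C; D \<in> Obj C\<rbrakk> \<Longrightarrow> inv_arr C (assoc C A B D) = (assoc C A B D)\<dagger>"
  using assoc_unitary by (simp add: unitary_def)

lemma dagger_frobenius_iff:
  assumes mon: "monoid_object C A m u"
  shows "dagger_frobenius_monoid C A m u \<longleftrightarrow>
    (\<one> A \<boxtimes> m) \<cdot> assoc C A A A \<cdot> ((m\<dagger> \<cdot> u) \<boxtimes> \<one> A) = m\<dagger> \<cdot> lunit C A"
    (is "_ \<longleftrightarrow> ?reduced")
proof
  have types [simp]: "A \<in> Obj C" "m \<in> Arr C" "Dom C m = A \<otimes> A" "Cod C m = A"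
      "u \<in> Arr C" "Dom C u = \<I>" "Cod C u = A"
    and massoc: "m \<cdot> (m \<boxtimes> \<one> A) = m \<cdot> (\<one> A \<boxtimes> m) \<cdot> assoc C A A A"
    and munit: "m \<cdot> (u \<boxtimes> \<one> A) = lunit C A"
    using mon by (auto simp: monoid_object_def hom_iff)
  let ?F = "(\<one> A \<boxtimes> m) \<cdot> assoc C A A A \<cdot> (m\<dagger> \<boxtimes> \<one> A)"
  \<comment> \<open>The inverse associator is written as its dagger, by unitarity. In this form
    \<open>?G\<close> is visibly \<open>?F\<close> reversed and daggered, so the Frobenius law says
    that \<open>?F\<close> is self-adjoint.\<close>
  let ?G = "(m \<boxtimes> \<one> A) \<cdot> (assoc C A A A)\<dagger> \<cdot> (\<one> A \<boxtimes> m\<dagger>)"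
  have split: "(\<one> A \<boxtimes> m) \<cdot> assoc C A A A \<cdot> ((m\<dagger> \<cdot> u) \<boxtimes> \<one> A) = ?F \<cdot> (u \<boxtimes> \<one> A)"
    by (simp add: comp_assoc_arr interchange)
  have GF: "?G = ?F\<dagger>"
    by (simp add: dagger_comp_arr dagger_tensor dagger_ident comp_assoc_arr)
  have frob: "dagger_frobenius_monoid C A m u \<longleftrightarrow> ?G = ?F"
    using mon by (simp add: dagger_frobenius_monoid_def inv_assoc)
  {
    assume "dagger_frobenius_monoid C A m u"
    then have "?F \<cdot> (u \<boxtimes> \<one> A) = ?G \<cdot> (u \<boxtimes> \<one> A)"
      using frob by simp
    also have "\<dots> = (m \<boxtimes> \<one> A) \<cdot> ((assoc C A A A)\<dagger> \<cdot> (u \<boxtimes> (\<one> A \<boxtimes> \<one> A))) \<cdot> (\<one> \<I> \<boxtimes> m\<dagger>)"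
      by (simp add: comp_assoc_arr interchange)
    \<comment> \<open>Naturality of the inverse associator at \<open>u\<close> is the dagger of
      naturality of \<open>assoc\<close> at \<open>u\<dagger>\<close>.\<close>
    also have "(assoc C A A A)\<dagger> \<cdot> (u \<boxtimes> (\<one> A \<boxtimes> \<one> A)) = ((u \<boxtimes> \<one> A) \<boxtimes> \<one> A) \<cdot> (assoc C \<I> A A)\<dagger>"
    proof -
      have "assoc C \<I> A A \<cdot> ((u\<dagger> \<boxtimes> \<one> A) \<boxtimes> \<one> A) = (u\<dagger> \<boxtimes> (\<one> A \<boxtimes> \<one> A)) \<cdot> assoc C A A A"
        by (subst assoc_natural_arr) simp_all
      from arg_cong[OF this, of "dagger C"] show ?thesis
        by (simp add: dagger_comp_arr dagger_tensor dagger_ident)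
    qed
    also have "(m \<boxtimes> \<one> A) \<cdot> (((u \<boxtimes> \<one> A) \<boxtimes> \<one> A) \<cdot> (assoc C \<I> A A)\<dagger>) \<cdot> (\<one> \<I> \<boxtimes> m\<dagger>)
        = (lunit C A \<boxtimes> \<one> A) \<cdot> (assoc C \<I> A A)\<dagger> \<cdot> (\<one> \<I> \<boxtimes> m\<dagger>)"
      by (simp add: comp_assoc_arr interchange_comp munit)
    \<comment> \<open>The unit law has left \<open>lunit C A \<boxtimes> \<one> A\<close>. Coherence
      splits off an associator from it, which cancels against its dagger; naturality of
      \<open>lunit\<close> at \<open>m\<dagger>\<close> finishes.\<close>
    also have "\<dots> = lunit C (A \<otimes> A) \<cdot> (assoc C \<I> A A \<cdot> (assoc C \<I> A A)\<dagger>) \<cdot> (\<one> \<I> \<boxtimes> m\<dagger>)"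
      by (simp add: comp_assoc_arr flip: lunit_tensor)
    also have "\<dots> = m\<dagger> \<cdot> lunit C A"
      by (simp add: unitary_comp_dagger assoc_unitary lunit_natural_arr)
    finally show ?reduced
      by (simp only: split)
  }
  {
    assume red: ?reduced
    let ?l = "lunit C A" and ?n = "m\<dagger> \<cdot> u"
    \<comment> \<open>Precomposing with \<open>?l \<boxtimes> \<one> A\<close> creates
      \<open>m\<dagger> \<cdot> ?l\<close>, which the reduced equation, read from right to left,
      replaces by an expression in \<open>?n\<close>. The added factor is invertible and is removed
      at the end.\<close>
    have "(?F \<cdot> (?l \<boxtimes> \<one> A)) = (\<one> A \<boxtimes> m) \<cdot> assoc C A A A \<cdot> ((m\<dagger> \<cdot> ?l) \<boxtimes> \<one> A)"
      by (simp add: comp_assoc_arr interchange)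
    also have "\<dots> = (\<one> A \<boxtimes> m) \<cdot> (assoc C A A A \<cdot> ((\<one> A \<boxtimes> m) \<boxtimes> \<one> A))
        \<cdot> (assoc C A A A \<boxtimes> \<one> A) \<cdot> ((?n \<boxtimes> \<one> A) \<boxtimes> \<one> A)"
      by (simp add: comp_assoc_arr interchange flip: red)
    \<comment> \<open>The inner multiplication slides through the associator to meet the outer one,
      so that associativity of \<open>m\<close> applies; the associators then form one side of the
      pentagon.\<close>
    also have "\<dots> = (\<one> A \<boxtimes> (m \<cdot> (m \<boxtimes> \<one> A))) \<cdot> assoc C A (A \<otimes> A) A
        \<cdot> (assoc C A A A \<boxtimes> \<one> A) \<cdot> ((?n \<boxtimes> \<one> A) \<boxtimes> \<one> A)"
      by (simp add: assoc_natural_arr comp_assoc_arr interchange_comp)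
    also have "\<dots> = (\<one> A \<boxtimes> m) \<cdot> (\<one> A \<boxtimes> (\<one> A \<boxtimes> m)) \<cdot> ((\<one> A \<boxtimes> assoc C A A A)
        \<cdot> assoc C A (A \<otimes> A) A \<cdot> (assoc C A A A \<boxtimes> \<one> A)) \<cdot> ((?n \<boxtimes> \<one> A) \<boxtimes> \<one> A)"
      unfolding massoc by (simp add: comp_assoc_arr interchange_comp)
    also have "\<dots> = (\<one> A \<boxtimes> m) \<cdot> ((\<one> A \<boxtimes> (\<one> A \<boxtimes> m)) \<cdot> assoc C A A (A \<otimes> A))
        \<cdot> (assoc C (A \<otimes> A) A A \<cdot> ((?n \<boxtimes> \<one> A) \<boxtimes> \<one> A))"
      unfolding pentagon[OF types(1) types(1) types(1) types(1), symmetric]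
      by (simp add: comp_assoc_arr)
    also have "(\<one> A \<boxtimes> (\<one> A \<boxtimes> m)) \<cdot> assoc C A A (A \<otimes> A) = assoc C A A A \<cdot> ((\<one> A \<boxtimes> \<one> A) \<boxtimes> m)"
      by (subst assoc_natural_arr) simp_all
    also have "assoc C (A \<otimes> A) A A \<cdot> ((?n \<boxtimes> \<one> A) \<boxtimes> \<one> A) = (?n \<boxtimes> (\<one> A \<boxtimes> \<one> A)) \<cdot> assoc C \<I> A A"
      by (subst assoc_natural_arr) simp_all
    \<comment> \<open>Now \<open>m\<close> acts on the last two factors and \<open>?n\<close> only
      creates the first two, so they commute. Moving \<open>m\<close> to the right exposes the left
      side of the reduced equation a second time.\<close>
    also have "(\<one> A \<boxtimes> m) \<cdot> (assoc C A A A \<cdot> ((\<one> A \<boxtimes> \<one> A) \<boxtimes> m))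
          \<cdot> ((?n \<boxtimes> (\<one> A \<boxtimes> \<one> A)) \<cdot> assoc C \<I> A A)
        = ((\<one> A \<boxtimes> m) \<cdot> assoc C A A A \<cdot> (?n \<boxtimes> \<one> A)) \<cdot> (\<one> \<I> \<boxtimes> m) \<cdot> assoc C \<I> A A"
      by (simp add: comp_assoc_arr interchange_comp)
    also have "\<dots> = m\<dagger> \<cdot> (?l \<cdot> (\<one> \<I> \<boxtimes> m)) \<cdot> assoc C \<I> A A"
      unfolding red by (simp add: comp_assoc_arr)
    \<comment> \<open>Naturality of \<open>lunit\<close> at \<open>m\<close> and coherence restore
      the factor \<open>?l \<boxtimes> \<one> A\<close> to be cancelled.\<close>
    also have "\<dots> = (m\<dagger> \<cdot> m) \<cdot> (?l \<boxtimes> \<one> A)"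
      by (simp add: lunit_natural_arr comp_assoc_arr lunit_tensor)
    finally have "?F = m\<dagger> \<cdot> m"
      by (rule iso_cancel_right[rotated -1]) (simp_all add: is_iso_tensor_ident lunit_iso)
    moreover have "(m\<dagger> \<cdot> m)\<dagger> = m\<dagger> \<cdot> m"
      by (simp add: dagger_comp_arr)
    ultimately show "dagger_frobenius_monoid C A m u"
      using frob GF by simp
  }
qed

end

section \<open>Currying, evaluation and naturality\<close>

context closed_monoidal_category
begin

lemma ihom_simps [simp]: "\<lbrakk>A \<in> Obj C; B \<in> Obj C\<rbrakk> \<Longrightarrow> ihom C A B \<in> Obj C"
  by (rule ihom_Obj)

lemma curry_simps [simp]:
  assumes "f \<in> Arr C" "Dom C f = A \<otimes> B" "Cod C f = D" "A \<in> Obj C" "B \<in> Obj C"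
  shows "curry C A B D f \<in> Arr C" "Dom C (curry C A B D f) = A"
    "Cod C (curry C A B D f) = ihom C B D"
proof -
  have "D \<in> Obj C" "f \<in> hom C (A \<otimes> B) D"
    using assms by (auto simp: hom_iff)
  then have "curry C A B D f \<in> hom C A (ihom C B D)"
    using bij_betw_apply[OF curry_bij] assms(4,5) by blast
  then show "curry C A B D f \<in> Arr C" "Dom C (curry C A B D f) = A"
    "Cod C (curry C A B D f) = ihom C B D"
    by (auto simp: hom_iff)
qed

lemma curry_inject:
  assumes "f \<in> hom C (A \<otimes> B) D" "g \<in> hom C (A \<otimes> B) D" "A \<in> Obj C" "B \<in> Obj C"
  shows "curry C A B D f = curry C A B D g \<longleftrightarrow> f = g"
proof -
  have "D \<in> Obj C"
    using assms(1) by (auto simp: hom_iff)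
  then show ?thesis
    using curry_bij[of A B D] assms by (auto simp: bij_betw_def dest: inj_onD)
qed

text \<open>Surjectivity of currying puts the identity of \<open>ihom C B D\<close> in its image, so
  \<open>the_inv_into\<close> in \<open>ev\<close> picks a genuine preimage.\<close>

lemma
  assumes "B \<in> Obj C" "D \<in> Obj C"
  shows ev_hom: "ev C B D \<in> hom C (ihom C B D \<otimes> B) D"
    and curry_ev: "curry C (ihom C B D) B D (ev C B D) = \<one> (ihom C B D)"
proof -
  let ?H = "hom C (ihom C B D \<otimes> B) D" and ?c = "curry C (ihom C B D) B D"
  have bij: "bij_betw ?c ?H (hom C (ihom C B D) (ihom C B D))"
    using assms by (simp add: curry_bij)
  then have inj: "inj_on ?c ?H" and mem: "\<one> (ihom C B D) \<in> ?c ` ?H"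
    using assms by (auto simp: bij_betw_def hom_iff)
  show "ev C B D \<in> ?H"
    unfolding ev_def by (rule the_inv_into_into[OF inj mem order_refl])
  show "?c (ev C B D) = \<one> (ihom C B D)"
    unfolding ev_def by (rule f_the_inv_into_f[OF inj mem])
qed

lemma ev_simps [simp]:
  assumes "B \<in> Obj C" "D \<in> Obj C"
  shows "ev C B D \<in> Arr C" "Dom C (ev C B D) = ihom C B D \<otimes> B" "Cod C (ev C B D) = D"
  using ev_hom[OF assms] by (auto simp: hom_iff)

lemma curry_comp_left:
  assumes "f \<in> Arr C" "Dom C f = A \<otimes> B" "Cod C f = D" "A \<in> Obj C" "B \<in> Obj C"
    "a \<in> Arr C" "Cod C a = A"
  shows "curry C A B D f \<cdot> a = curry C (Dom C a) B D (f \<cdot> (a \<boxtimes> \<one> B))"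
proof -
  have "D \<in> Obj C"
    using assms by auto
  then show ?thesis
    using curry_natural[of f A B D a "Dom C a" "\<one> B" B "\<one> D" D] assms
    by (simp add: hom_iff ihom_arr_ident)
qed

text \<open>Naturality of currying in the exponent. Taking \<open>b\<close> to be the dagger of
  \<open>cayley C A m\<close> computes composites with \<open>cayley_dual\<close>.\<close>

lemma ihom_arr_curry:
  assumes "f \<in> Arr C" "Dom C f = A \<otimes> B" "Cod C f = D" "A \<in> Obj C"
    "b \<in> Arr C" "Cod C b = B"
  shows "ihom_arr C b (\<one> D) \<cdot> curry C A B D f = curry C A (Dom C b) D (f \<cdot> (\<one> A \<boxtimes> b))"
proof -
  have "B \<in> Obj C" "D \<in> Obj C"
    using assms by auto
  then show ?thesis
    using curry_natural[of f A B D "\<one> A" A b "Dom C b" "\<one> D" D] assms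
    by (simp add: hom_iff)
qed

text \<open>The beta rule: by naturality and \<open>curry_ev\<close> both sides have the same
  currying, and currying is injective.\<close>

lemma ev_curry:
  assumes "f \<in> Arr C" "Dom C f = A \<otimes> B" "Cod C f = D" "A \<in> Obj C" "B \<in> Obj C"
  shows "ev C B D \<cdot> (curry C A B D f \<boxtimes> \<one> B) = f"
proof -
  have D: "D \<in> Obj C"
    using assms by auto
  have "curry C A B D (ev C B D \<cdot> (curry C A B D f \<boxtimes> \<one> B)) = curry C A B D f"
    using curry_comp_left[of "ev C B D" "ihom C B D" B D "curry C A B D f"] assms D
    by (simp add: curry_ev)
  then show ?thesis
    using assms D by (subst (asm) curry_inject) (simp_all add: hom_iff)
qed

end

section \<open>The sheathing axioms and the dual equation\<close>

context sheathed_dagger_category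
begin

lemma end_simps [simp]:
  assumes "A \<in> Obj C"
  shows "end_mult C A \<in> Arr C" "Dom C (end_mult C A) = ihom C A A \<otimes> ihom C A A"
    "Cod C (end_mult C A) = ihom C A A"
    "end_unit C A \<in> Arr C" "Dom C (end_unit C A) = \<I>" "Cod C (end_unit C A) = ihom C A A"
  using assms by (simp_all add: end_mult_def end_unit_def Let_def)

text \<open>This is the dagger of the first sheathing axiom, with \<open>lunit\<close> moved across
  by unitarity. It has the shape of the reduced Frobenius equation, with \<open>ev\<close> acting in
  place of \<open>m\<close>.\<close>

lemma ev_dagger_eq:
  assumes A: "A \<in> Obj C" and E: "E = ihom C A A"
  shows "(\<one> E \<boxtimes> ev C A A) \<cdot> assoc C E E A \<cdot> (((end_mult C A)\<dagger> \<cdot> end_unit C A) \<boxtimes> \<one> A)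
    = (ev C A A)\<dagger> \<cdot> lunit C A"
proof -
  let ?X = "(\<one> E \<boxtimes> ev C A A) \<cdot> assoc C E E A \<cdot> (((end_mult C A)\<dagger> \<cdot> end_unit C A) \<boxtimes> \<one> A)"
  have "(ev C A A)\<dagger> = ?X \<cdot> (lunit C A)\<dagger>"
    using arg_cong[OF ev_dagger[OF A E], of "dagger C"] A E
    by (simp add: dagger_comp_arr dagger_tensor dagger_ident inv_assoc comp_assoc_arr)
  then have "(ev C A A)\<dagger> \<cdot> lunit C A = ?X \<cdot> (lunit C A)\<dagger> \<cdot> lunit C A"
    using A E by (simp add: comp_assoc_arr)
  then show ?thesis
    using A E by (simp add: unitary_comp_dagger lunit_unitary)
qed

lemma cayley_simps [simp]:
  assumes "A \<in> Obj C" "m \<in> hom C (A \<otimes> A) A"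
  shows "cayley C A m \<in> Arr C" "Dom C (cayley C A m) = A" "Cod C (cayley C A m) = ihom C A A"
  using assms by (simp_all add: cayley_def hom_iff)

lemma ev_cayley:
  assumes "A \<in> Obj C" "m \<in> hom C (A \<otimes> A) A"
  shows "ev C A A \<cdot> (cayley C A m \<boxtimes> \<one> A) = m"
  using assms by (simp add: cayley_def hom_iff ev_curry)

lemma to_dual_cayley_iff:
  assumes A [simp]: "A \<in> Obj C" and m: "m \<in> hom C (A \<otimes> A) A" and u: "u \<in> hom C \<I> A"
  shows "to_dual C (ihom C A A) (end_mult C A) (end_unit C A) \<cdot> cayley C A m
      = cayley_dual C A m \<cdot> to_dual C A m u
    \<longleftrightarrow> (\<one> A \<boxtimes> m) \<cdot> assoc C A A A \<cdot> ((m\<dagger> \<cdot> u) \<boxtimes> \<one> A) = m\<dagger> \<cdot> lunit C A"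
proof -
  define E where "E = ihom C A A"
  define R where "R = cayley C A m"
  define e where "e = ev C A A"
  have [simp]: "m \<in> Arr C" "Dom C m = A \<otimes> A" "Cod C m = A"
      "u \<in> Arr C" "Dom C u = \<I>" "Cod C u = A"
    using m u by (auto simp: hom_iff)
  have [simp]: "E \<in> Obj C" "R \<in> Arr C" "Dom C R = A" "Cod C R = E"
      "e \<in> Arr C" "Dom C e = E \<otimes> A" "Cod C e = A"
    using m by (simp_all add: E_def R_def e_def)
  have [simp]: "end_mult C A \<in> Arr C" "Dom C (end_mult C A) = E \<otimes> E" "Cod C (end_mult C A) = E"
      "end_unit C A \<in> Arr C" "Dom C (end_unit C A) = \<I>" "Cod C (end_unit C A) = E"
    by (simp_all add: E_def)
  have eR: "e \<cdot> (R \<boxtimes> \<one> A) = m"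
    using ev_cayley[OF A m] by (simp add: e_def R_def)
  have Re: "(R\<dagger> \<boxtimes> \<one> A) \<cdot> e\<dagger> = m\<dagger>"
    using arg_cong[OF eR, of "dagger C"] by (simp add: dagger_comp_arr dagger_tensor dagger_ident)
  let ?n = "(end_mult C A)\<dagger> \<cdot> end_unit C A"
  \<comment> \<open>The arrows \<open>?f\<close> and \<open>?g\<close> from \<open>\<I>\<close> to
    \<open>A \<otimes> E\<close> are the daggers of the two uncurried sides. Taking daggers puts
    \<open>E\<close> in the codomain, as the separation axiom requires.\<close>
  let ?f = "(R\<dagger> \<boxtimes> \<one> E) \<cdot> ?n" and ?g = "(\<one> A \<boxtimes> R) \<cdot> m\<dagger> \<cdot> u"
  let ?sep = "\<lambda>h. (\<one> A \<boxtimes> e) \<cdot> assoc C A E A \<cdot> (h \<boxtimes> \<one> A)"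
  have "to_dual C E (end_mult C A) (end_unit C A) \<cdot> R
      = curry C A E \<I> (((end_unit C A)\<dagger> \<cdot> end_mult C A) \<cdot> (R \<boxtimes> \<one> E))"
    by (simp add: to_dual_def curry_comp_left)
  also have "((end_unit C A)\<dagger> \<cdot> end_mult C A) \<cdot> (R \<boxtimes> \<one> E) = ?f\<dagger>"
    by (simp add: dagger_comp_arr dagger_tensor dagger_ident)
  finally have L: "to_dual C E (end_mult C A) (end_unit C A) \<cdot> R = curry C A E \<I> (?f\<dagger>)" .
  have "cayley_dual C A m \<cdot> to_dual C A m u = curry C A E \<I> ((u\<dagger> \<cdot> m) \<cdot> (\<one> A \<boxtimes> R\<dagger>))"
    by (simp add: to_dual_def cayley_dual_def ihom_arr_curry flip: R_def)
  also have "(u\<dagger> \<cdot> m) \<cdot> (\<one> A \<boxtimes> R\<dagger>) = ?g\<dagger>"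
    by (simp add: dagger_comp_arr dagger_tensor dagger_ident)
  finally have R: "cayley_dual C A m \<cdot> to_dual C A m u = curry C A E \<I> (?g\<dagger>)" .
  \<comment> \<open>Injectivity of currying and of the dagger removes both.\<close>
  have "to_dual C E (end_mult C A) (end_unit C A) \<cdot> R = cayley_dual C A m \<cdot> to_dual C A m u
      \<longleftrightarrow> ?f = ?g"
    unfolding L R by (subst curry_inject) (simp_all add: hom_iff dagger_inject)
  also have "\<dots> \<longleftrightarrow> ?sep ?f = ?sep ?g"
  proof
    assume "?sep ?f = ?sep ?g"
    then show "?f = ?g"
      by (intro ev_separates[OF A unit_Obj A E_def, of ?f ?g]) (simp_all add: hom_iff flip: e_def)
  qed simp
  also have "?sep ?f = m\<dagger> \<cdot> lunit C A"
  proof -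
    \<comment> \<open>\<open>R\<dagger>\<close> acts on the first factor and \<open>e\<close> on the
      last two, so \<open>R\<dagger>\<close> moves out to the left. What remains is the left side of
      \<open>ev_dagger_eq\<close>, and \<open>R\<dagger>\<close> turns the resulting
      \<open>e\<dagger>\<close> into \<open>m\<dagger>\<close>.\<close>
    have "?sep ?f = (\<one> A \<boxtimes> e) \<cdot> (assoc C A E A \<cdot> ((R\<dagger> \<boxtimes> \<one> E) \<boxtimes> \<one> A)) \<cdot> (?n \<boxtimes> \<one> A)"
      by (simp add: comp_assoc_arr interchange)
    also have "\<dots> = (R\<dagger> \<boxtimes> \<one> A) \<cdot> (\<one> E \<boxtimes> e) \<cdot> assoc C E E A \<cdot> (?n \<boxtimes> \<one> A)"
      by (simp add: assoc_natural_arr comp_assoc_arr interchange_comp)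
    also have "\<dots> = ((R\<dagger> \<boxtimes> \<one> A) \<cdot> e\<dagger>) \<cdot> lunit C A"
      using ev_dagger_eq[OF A E_def] by (simp add: comp_assoc_arr flip: e_def)
    finally show ?thesis
      by (simp only: Re)
  qed
  also have "?sep ?g = (\<one> A \<boxtimes> m) \<cdot> assoc C A A A \<cdot> ((m\<dagger> \<cdot> u) \<boxtimes> \<one> A)"
  proof -
    \<comment> \<open>Here \<open>R\<close> sits on the middle factor; it slides through the
      associator to \<open>e\<close>, where the two compose to \<open>m\<close>.\<close>
    have "?sep ?g = (\<one> A \<boxtimes> e) \<cdot> (assoc C A E A \<cdot> ((\<one> A \<boxtimes> R) \<boxtimes> \<one> A)) \<cdot> ((m\<dagger> \<cdot> u) \<boxtimes> \<one> A)"
      by (simp add: comp_assoc_arr interchange)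
    also have "\<dots> = (\<one> A \<boxtimes> (e \<cdot> (R \<boxtimes> \<one> A))) \<cdot> assoc C A A A \<cdot> ((m\<dagger> \<cdot> u) \<boxtimes> \<one> A)"
      by (simp add: assoc_natural_arr comp_assoc_arr interchange_comp)
    finally show ?thesis
      by (simp only: eR)
  qed
  finally show ?thesis
    \<comment> \<open>The chain ends with the sides of the last equation exchanged.\<close>
    unfolding E_def R_def by (simp only: eq_commute)
qed

end

theorem theorem9p10:
  fixes C :: "('o, 'a, 'x) dagger_closed_data_scheme" (structure)
    and A :: 'o and m u :: 'a
  assumes "sheathed_dagger_category C"
    and "monoid_object C A m u"
  shows "dagger_frobenius_monoid C A m u \<longleftrightarrow>
    to_dual C (ihom C A A) (end_mult C A) (end_unit C A) \<cdot> cayley C A m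
      = cayley_dual C A m \<cdot> to_dual C A m u"
proof -
  interpret sheathed_dagger_category C
    by fact
  \<comment> \<open>Both equivalences end in the same reduced equation.\<close>
  show ?thesis
    using dagger_frobenius_iff[OF assms(2)] to_dual_cayley_iff[of A m u] assms(2)
    by (simp add: monoid_object_def)
qed

end
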